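(* Let $m\ge1$ and $q\in(0,1)$. Let $H_1,\dots,H_m$ be null hypotheses (each with a fixed truth status), and suppose $p_1,\dots,p_m\in[0,1]$ are independent $p$-values satisfying $p_i\sim\mathrm{Uniform}(0,1)$ when $H_i$ is true. Let $\hat\lambda=\hat\lambda(p_1,\dots,p_m)$ be a $[q,1]$-valued stopping time with respect to the filtration $$\mathcal F_t=\sigma\Big(\sum_{i=1}^m 1\{p_i>s\}:\ q\le s\le t\Big),\qquad t\ge q,$$ and let $$\hat\pi_0=\frac{1+\#\{i\le m:p_i>\hat\lambda\}}{m(1-\hat\lambda)},\qquad R_{q/\hat\pi_0}=\operatorname{argmin}_{k:\,p_{(k)}\le q}\Big\{p_{(k)}-\frac{qk}{\hat\pi_0 m}\Big\}.$$ Then the rejection set $\mathcal R_{q/\hat\pi_0}=\{i:p_i\le p_{(R_{q/\hat\pi_0})}\}$ satisfies $$\mathrm{bFDR}(\mathcal R_{q/\hat\pi_0})\le q.$$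
   Context: Order statistics: $p_{(1)}\le\dots\le p_{(m)}$ are the sorted $p$-values, $p_{(0)}:=0$ (so $k=0$ is always allowed in the argmin); $H_{(k)}$ is the null hypothesis whose $p$-value is $p_{(k)}$, and $H_{(0)}$ is false by definition. Boundary FDR: for a procedure making $R$ rejections, $\mathcal R=\{i:p_i\le p_{(R)}\}$, $\mathrm{bFDR}(\mathcal R):=\mathbb P(H_{(R)}\text{ is true},\ R>0)$. If $\hat\lambda=1$, then $1/\hat\pi_0$ is read as $0$; in general $\frac{1}{\hat\pi_0 m}=\frac{1-\hat\lambda}{1+\#\{i\le m:p_i>\hat\lambda\}}$. *)

theory Defs
  imports "HOL-Probability.Probability"
begin

text \<open>
  Hypotheses are indexed by \<open>{1..m}\<close>; \<open>H i\<close> says that the \<open>i\<close>-th null hypothesis is true.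
  Functions of one realisation of the p-values take it as a vector \<open>x :: nat \<Rightarrow> real\<close>, of which
  only the entries in \<open>{1..m}\<close> matter.
\<close>

definition order_stat :: "nat \<Rightarrow> (nat \<Rightarrow> real) \<Rightarrow> nat \<Rightarrow> real" where
  "order_stat m x k = (if k = 0 then 0 else sort (map x [1..<Suc m]) ! (k - 1))"

definition count_above :: "nat \<Rightarrow> (nat \<Rightarrow> real) \<Rightarrow> real \<Rightarrow> nat" where
  "count_above m x s = card {i \<in> {1..m}. x i > s}"

text \<open>
  If a true null is tied with another p-value, ``the hypothesis whose p-value is the \<open>k\<close>-th
  smallest'' is ambiguous. The definition then counts it as true, so that it covers every way of
  breaking the tie.
\<close>

definition ordered_null :: "nat \<Rightarrow> (nat \<Rightarrow> bool) \<Rightarrow> (nat \<Rightarrow> real) \<Rightarrow> nat \<Rightarrow> bool" where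
  "ordered_null m H x k \<longleftrightarrow> 0 < k \<and> (\<exists>i\<in>{1..m}. H i \<and> x i = order_stat m x k)"

definition rejection_set :: "nat \<Rightarrow> (nat \<Rightarrow> real) \<Rightarrow> nat \<Rightarrow> nat set" where
  "rejection_set m x r = {i \<in> {1..m}. x i \<le> order_stat m x r}"

text \<open>The number of rejections of a procedure is the cardinality of its rejection set.\<close>

definition bFDR ::
  "'a measure \<Rightarrow> nat \<Rightarrow> (nat \<Rightarrow> bool) \<Rightarrow> (nat \<Rightarrow> 'a \<Rightarrow> real) \<Rightarrow> ('a \<Rightarrow> nat set) \<Rightarrow> real" where
  "bFDR M m H p Rej =
     measure M {\<omega> \<in> space M. ordered_null m H (\<lambda>i. p i \<omega>) (card (Rej \<omega>)) \<and> card (Rej \<omega>) > 0}"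

text \<open>
  For \<open>t < q\<close> this is the trivial \<open>\<sigma>\<close>-algebra. A \<open>[q,1]\<close>-valued time never stops before \<open>q\<close>, so
  extending the index set from \<open>t \<ge> q\<close> to all reals does not change its being a stopping time.
\<close>

definition count_filtration ::
  "'a measure \<Rightarrow> nat \<Rightarrow> (nat \<Rightarrow> 'a \<Rightarrow> real) \<Rightarrow> real \<Rightarrow> real \<Rightarrow> 'a measure" where
  "count_filtration M m p q t = sigma (space M)
     {(\<lambda>\<omega>. count_above m (\<lambda>i. p i \<omega>) s) -` A \<inter> space M | s A. s \<in> {q..t}}"

text \<open>
  For \<open>l = 1\<close> the estimate is \<open>0\<close> (division by zero), hence so is its inverse, which is the
  convention \<open>1 / pi0_hat = 0\<close> for that case.
\<close>

definition pi0_hat :: "nat \<Rightarrow> (nat \<Rightarrow> real) \<Rightarrow> real \<Rightarrow> real" where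
  "pi0_hat m x l = (1 + real (count_above m x l)) / (real m * (1 - l))"

text \<open>
  \<open>k\<close> is a minimiser in the definition of the rejection count \<open>R\<close> with estimate \<open>c\<close> of the null
  proportion. Minimisers need not be unique, since the p-values of false nulls may be tied, so
  this is a relation rather than a function.
\<close>

definition is_rejection_count :: "nat \<Rightarrow> real \<Rightarrow> (nat \<Rightarrow> real) \<Rightarrow> real \<Rightarrow> nat \<Rightarrow> bool" where
  "is_rejection_count m q x c k \<longleftrightarrow>
     is_arg_min (\<lambda>k. order_stat m x k - q * real k / (c * real m))
       (\<lambda>k. k \<in> {0..m} \<and> order_stat m x k \<le> q) k"

end

theory Submission
  imports Defs
begin

text \<open>
  Fix a true null \<open>i\<close> and let \<open>l\<^sub>i\<close> be the stopping time and \<open>N\<^sub>i\<close> the number of p-values above it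
  when \<open>p\<^sub>i\<close> is reset to \<open>0\<close>. On \<open>p\<^sub>i \<le> q\<close> the reset changes nothing that the stopping time sees,
  so the slope of the support line is \<open>c\<^sub>i = q (1 - l\<^sub>i) / (1 + N\<^sub>i)\<close>, which depends only on the
  other p-values. Given those, the values of \<open>p\<^sub>i\<close> that make it the last rejected p-value have
  Lebesgue measure at most \<open>c\<^sub>i\<close>. Since \<open>1 - l\<^sub>i\<close> is the conditional probability of \<open>p\<^sub>i > l\<^sub>i\<close>, the
  boundary FDR is at most \<open>q\<close> times the expectation of the sum of \<open>1 / (1 + N\<^sub>i)\<close> over the true nulls
  with \<open>p\<^sub>i > l\<^sub>i\<close>. This sum is at most \<open>1\<close> pointwise, so no martingale argument is needed.
\<close>

section \<open>The minimiser as a condition on one p-value\<close>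

definition count_le :: "nat \<Rightarrow> (nat \<Rightarrow> real) \<Rightarrow> real \<Rightarrow> nat" where
  "count_le m x s = card {i \<in> {1..m}. x i \<le> s}"

lemma count_le_conv_sort:
  "count_le m x s = card {j. j < m \<and> sort (map x [1..<Suc m]) ! j \<le> s}"
proof -
  let ?L = "map x [1..<Suc m]"
  have "count_le m x s = length (filter (\<lambda>i. x i \<le> s) [1..<Suc m])"
    by (subst distinct_length_filter)
      (auto simp: count_le_def intro!: arg_cong[where f = card])
  also have "\<dots> = length (filter (\<lambda>v. v \<le> s) ?L)"
    by (simp add: filter_map o_def)
  also have "\<dots> = size (filter_mset (\<lambda>v. v \<le> s) (mset (sort ?L)))"
    by (metis mset_filter mset_sort size_mset)
  also have "\<dots> = length (filter (\<lambda>v. v \<le> s) (sort ?L))"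
    by (metis mset_filter size_mset)
  also have "\<dots> = card {j. j < m \<and> sort ?L ! j \<le> s}"
    by (subst length_filter_conv_card) simp
  finally show ?thesis .
qed

lemma count_le_le: "count_le m x s \<le> m"
  unfolding count_le_def by (rule order_trans[OF card_mono[of "{1..m}"]]) auto

text \<open>With \<open>order_stat_le\<close> and the monotonicity of \<open>count_le\<close> in the
  threshold, this gives the Galois connection between ranks and thresholds. The first
  \<open>k\<close> entries of the sorted list are all at most the last of them.\<close>

lemma count_le_order_stat:
  assumes "0 < k" "k \<le> m"
  shows "k \<le> count_le m x (order_stat m x k)"
proof -
  let ?L = "sort (map x [1..<Suc m])"
  have "{..<k} \<subseteq> {j. j < m \<and> ?L ! j \<le> ?L ! (k - 1)}"
    using assms by (auto intro!: sorted_nth_mono)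
  from card_mono[OF _ this] show ?thesis
    using assms by (simp add: count_le_conv_sort order_stat_def)
qed

lemma order_stat_le:
  assumes "0 < k" "k \<le> count_le m x s"
  shows "order_stat m x k \<le> s"
proof (rule ccontr)
  let ?L = "sort (map x [1..<Suc m])"
  assume "\<not> order_stat m x k \<le> s"
  then have s: "s < ?L ! (k - 1)" using assms by (simp add: order_stat_def)
  have "{j. j < m \<and> ?L ! j \<le> s} \<subseteq> {..<k - 1}"
  proof
    fix j assume j: "j \<in> {j. j < m \<and> ?L ! j \<le> s}"
    have "\<not> k - 1 \<le> j"
    proof
      assume "k - 1 \<le> j"
      then have "?L ! (k - 1) \<le> ?L ! j" using j by (intro sorted_nth_mono) auto
      with j s show False by auto
    qed
    then show "j \<in> {..<k - 1}" by simp
  qed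
  from card_mono[OF _ this] have "count_le m x s \<le> k - 1"
    by (simp add: count_le_conv_sort)
  with assms show False by simp
qed

lemma order_stat_nonneg:
  assumes "\<And>i. i \<in> {1..m} \<Longrightarrow> 0 \<le> x i" "k \<le> m"
  shows "0 \<le> order_stat m x k"
proof (cases "k = 0")
  case False
  let ?L = "sort (map x [1..<Suc m])"
  have "?L ! (k - 1) \<in> set ?L" using False assms by (intro nth_mem) auto
  then show ?thesis using False assms by (auto simp: order_stat_def)
qed (simp add: order_stat_def)

text \<open>\<open>bFDR\<close> looks at the order statistic whose index is the size of the
  rejection set, and ties at the threshold can make that size exceed \<open>r\<close>. The size is
  the last index whose order statistic is at most the threshold, so both indices name the same
  value.\<close>

lemma order_stat_card_rejection_set:
  assumes x: "\<And>i. i \<in> {1..m} \<Longrightarrow> 0 \<le> x i" and r: "r \<le> m"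
    and pos: "0 < card (rejection_set m x r)"
  shows "order_stat m x (card (rejection_set m x r)) = order_stat m x r"
proof -
  let ?t = "order_stat m x r"
  have c: "card (rejection_set m x r) = count_le m x ?t"
    by (simp add: rejection_set_def count_le_def)
  have "order_stat m x (count_le m x ?t) \<le> ?t"
    using pos c by (intro order_stat_le) auto
  moreover have "?t \<le> order_stat m x (count_le m x ?t)"
  proof (cases "r = 0")
    \<comment> \<open>For \<open>r = 0\<close> the threshold is the conventional 0, and p-values
      equal to 0 are still rejected; nonnegativity settles this case.\<close>
    case True
    then show ?thesis
      using order_stat_nonneg[of m x "count_le m x ?t"] x count_le_le by (simp add: order_stat_def)
  next
    case False
    have "count_le m x ?t \<le> count_le m x (order_stat m x (count_le m x ?t))"
      using pos c by (intro count_le_order_stat count_le_le) auto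
    then have "r \<le> count_le m x (order_stat m x (count_le m x ?t))"
      using count_le_order_stat[of r m x] False r by simp
    then show ?thesis using False by (intro order_stat_le) auto
  qed
  ultimately show ?thesis using c by simp
qed

text \<open>The argmin over ranks, restated over thresholds so that it constrains a single
  coordinate without sorting. The slope \<open>c\<close> is a separate argument so that it can later
  be computed from the other p-values. The weak inequality admits every minimiser.\<close>

definition boundary_at :: "nat \<Rightarrow> real \<Rightarrow> real \<Rightarrow> (nat \<Rightarrow> real) \<Rightarrow> nat \<Rightarrow> bool" where
  "boundary_at m q c x i \<longleftrightarrow> x i \<le> q \<and>
     (\<forall>s\<in>{0..q}. x i - c * count_le m x (x i) \<le> s - c * count_le m x s)"

text \<open>Passing from rank \<open>r\<close> to the possibly larger
  \<open>count_le m x (x i)\<close> cannot raise the objective, since \<open>c\<close> is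
  nonnegative. A threshold \<open>s\<close> does no better than the order statistic of rank
  \<open>count_le m x s\<close>, which is at most \<open>s\<close>.\<close>

lemma boundary_at_rejection_count:
  assumes R: "is_rejection_count m q x (pi0_hat m x l) r"
    and x: "\<And>i. i \<in> {1..m} \<Longrightarrow> 0 \<le> x i" and m: "1 \<le> m" and q: "0 < q" and l: "l \<le> 1"
    and i: "x i = order_stat m x r"
  shows "boundary_at m q (q * ((1 - l) / (1 + count_above m x l))) x i"
proof -
  define c where "c = q * ((1 - l) / (1 + count_above m x l))"
  have c0: "0 \<le> c" using q l by (auto simp: c_def)
  \<comment> \<open>At \<open>l = 1\<close> both sides vanish: the estimate is 0 and division by it
    gives 0.\<close>
  have ck: "q * real k / (pi0_hat m x l * real m) = c * real k" for k
  proof -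
    have "pi0_hat m x l * real m = (1 + count_above m x l) / (1 - l)"
      using m by (simp add: pi0_hat_def)
    then show ?thesis by (simp add: c_def)
  qed
  have r: "r \<le> m" "order_stat m x r \<le> q"
    and min: "\<And>k. k \<le> m \<Longrightarrow> order_stat m x k \<le> q \<Longrightarrow>
      order_stat m x r - c * r \<le> order_stat m x k - c * k"
    using R unfolding is_rejection_count_def is_arg_min_def ck by (auto simp: not_less)
  have rle: "r \<le> count_le m x (x i)"
    using count_le_order_stat[of r m x] r i by (cases "r = 0") auto
  have "x i - c * count_le m x (x i) \<le> s - c * count_le m x s" if s: "s \<in> {0..q}" for s
  proof -
    let ?k = "count_le m x s"
    have k: "order_stat m x ?k \<le> s"
      using s order_stat_le[of ?k m x s] by (cases "?k = 0") (auto simp: order_stat_def)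
    have "x i - c * count_le m x (x i) \<le> order_stat m x r - c * r"
      using rle c0 i by (simp add: mult_left_mono)
    also have "\<dots> \<le> order_stat m x ?k - c * ?k"
      using k s by (intro min count_le_le) auto
    also have "\<dots> \<le> s - c * ?k" using k by simp
    finally show ?thesis .
  qed
  then show ?thesis using r i unfolding boundary_at_def c_def[symmetric] by auto
qed

text \<open>Between two consecutive p-values \<open>s - c * count_le m x s\<close> increases in \<open>s\<close>, so finitely
  many \<open>s\<close> decide, which makes the condition measurable.\<close>

lemma boundary_at_finite:
  assumes x: "\<And>j. j \<in> {1..m} \<Longrightarrow> 0 \<le> x j" and q: "0 < q"
  shows "boundary_at m q c x i \<longleftrightarrow> x i \<le> q \<and> 
     x i - c * count_le m x (x i) \<le> - c * count_le m x 0 \<and>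
     (\<forall>j\<in>{1..m}. x j \<le> q \<longrightarrow> x i - c * count_le m x (x i) \<le> x j - c * count_le m x (x j))"
    (is "?L \<longleftrightarrow> ?R")
proof
  assume ?L then show ?R using x q by (force simp: boundary_at_def)
next
  assume R: ?R
  have "x i - c * count_le m x (x i) \<le> s - c * count_le m x s" if s: "s \<in> {0..q}" for s
  proof -
    \<comment> \<open>Lowering \<open>s\<close> to the nearest candidate at or below it keeps the
      count and does not raise the objective; the candidate 0 keeps the set nonempty.\<close>
    define S where "S = {v \<in> insert 0 (x ` {1..m}). v \<le> s}"
    have S: "finite S" "S \<noteq> {}" using s by (auto simp: S_def)
    have M: "Max S \<in> S" using Max_in[OF S] .
    have "x j \<le> s \<longleftrightarrow> x j \<le> Max S" if "j \<in> {1..m}" for j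
    proof
      assume "x j \<le> s"
      then show "x j \<le> Max S" using that by (intro Max_ge S) (auto simp: S_def)
    next
      assume "x j \<le> Max S"
      also have "\<dots> \<le> s" using M by (simp add: S_def)
      finally show "x j \<le> s" .
    qed
    then have "count_le m x s = count_le m x (Max S)"
      unfolding count_le_def by (intro arg_cong[where f = card]) auto
    moreover have "x i - c * count_le m x (x i) \<le> Max S - c * count_le m x (Max S)"
      using M R s unfolding S_def by fastforce
    ultimately show ?thesis using M by (auto simp: S_def)
  qed
  then show ?L using R by (auto simp: boundary_at_def)
qed

section \<open>Lebesgue measure of the boundary values of one coordinate\<close>

text \<open>On the piece of \<open>A\<close> where \<open>F = k\<close> the map \<open>y \<mapsto> y - c * F y\<close> is a translation. The images
  of different pieces share at most one point, and all of them lie in an interval of length \<open>c\<close>.\<close>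

lemma emeasure_increasing_part_le:
  fixes F :: "real \<Rightarrow> nat" and c :: real
  assumes A: "A \<in> sets borel" "A \<subseteq> {a..b}"
    and F: "F \<in> borel \<rightarrow>\<^sub>M count_space UNIV" "mono F" "\<And>y. F y \<le> n"
    and c: "0 \<le> c"
    and lo: "\<And>y z. y \<in> A \<Longrightarrow> z \<in> A \<Longrightarrow> y < z \<Longrightarrow> y - c * F y \<le> z - c * F z"
    and hi: "\<And>y z. y \<in> A \<Longrightarrow> z \<in> A \<Longrightarrow> y < z \<Longrightarrow> z - c * F z \<le> y - c * F y + c"
  shows "emeasure lborel A \<le> ennreal c"
proof -
  define B where "B k = A \<inter> F -` {k}" for k
  define T where "T k = (+) (- (c * real k)) ` B k" for k
  have Bs: "B k \<in> sets borel" for k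
    using A(1) measurable_sets[OF F(1), of "{k}"] by (simp add: B_def sets.Int)
  have bd: "bounded (B k)" for k
    by (rule bounded_subset[of "{a..b}"]) (use A in \<open>auto simp: B_def\<close>)
  have Bm: "B k \<in> lmeasurable" for k
    using Bs bd by (intro bounded_set_imp_lmeasurable) auto
  have Tm: "T k \<in> lmeasurable" for k
    unfolding T_def by (rule measurable_translation[OF Bm])
  have pw: "pairwise (\<lambda>k l. negligible (T k \<inter> T l)) {..n}"
  proof (rule pairwiseI)
    have *: "negligible (T k \<inter> T l)" if "k < l" for k l
    proof (cases "T k \<inter> T l = {}")
      case False
      then obtain v where v: "v \<in> T k" "v \<in> T l" by auto
      \<comment> \<open>Monotonicity of \<open>F\<close> puts piece \<open>k\<close> to the left of
        piece \<open>l\<close>, and \<open>lo\<close> carries this order over to the translates, so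
        these meet in at most one point.\<close>
      have lt: "y < z" if "y \<in> B k" "z \<in> B l" for y z
        using monoD[OF F(2), of z y] that \<open>k < l\<close> by (fastforce simp: B_def not_less)
      have le: "u \<le> w" if "u \<in> T k" "w \<in> T l" for u w
        using that lt lo by (fastforce simp: T_def B_def)
      have "T k \<inter> T l \<subseteq> {v}" using le v by (auto intro: antisym)
      then show ?thesis by (rule negligible_subset[OF negligible_sing])
    qed simp
    fix k l :: nat assume "k \<noteq> l"
    then show "negligible (T k \<inter> T l)" using *[of k l] *[of l k]
      by (cases "k < l") (auto simp: Int_commute)
  qed
  have pwB: "pairwise (\<lambda>k l. negligible (B k \<inter> B l)) {..n}"
    by (auto simp: pairwise_def B_def intro!: negligible_subset[OF negligible_empty])
  have U: "A = (\<Union>k\<le>n. B k)" using F(3) by (auto simp: B_def)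
  have "measure lebesgue A = (\<Sum>k\<le>n. measure lebesgue (B k))"
    unfolding U using Bm pwB by (intro measure_negligible_finite_Union_image) auto
  also have "\<dots> = (\<Sum>k\<le>n. measure lebesgue (T k))"
    unfolding T_def by (simp only: measure_translation)
  also have "\<dots> = measure lebesgue (\<Union>k\<le>n. T k)"
    using Tm pw by (intro measure_negligible_finite_Union_image[symmetric]) auto
  also have "\<dots> \<le> c"
  proof (cases "A = {}")
    case True
    then show ?thesis using c by (simp add: T_def B_def)
  next
    case False
    define G where "G y = y - c * F y" for y
    have TG: "(\<Union>k\<le>n. T k) = G ` A"
      using F(3) by (auto simp: T_def B_def G_def image_iff Bex_def)
    \<comment> \<open>The oscillation of \<open>G\<close> on \<open>A\<close> is at most
      \<open>c\<close>: by \<open>lo\<close> if \<open>z\<close> is below \<open>y\<close>, by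
      \<open>hi\<close> if it is above.\<close>
    have osc: "G z \<le> G y + c" if "y \<in> A" "z \<in> A" for y z
      using lo[of z y] hi[of y z] that c unfolding G_def by (cases y z rule: linorder_cases) auto
    obtain y0 where y0: "y0 \<in> A" using False by auto
    have bb: "bdd_below (G ` A)"
      by (rule bdd_belowI[of _ "G y0 - c"]) (use osc y0 in fastforce)
    define g where "g = Inf (G ` A)"
    have "G z - c \<le> g" if "z \<in> A" for z
      unfolding g_def by (rule cInf_greatest) (use osc that False in fastforce)+
    moreover have "g \<le> G z" if "z \<in> A" for z
      unfolding g_def using bb that by (intro cInf_lower) auto
    ultimately have "(\<Union>k\<le>n. T k) \<subseteq> {g..g + c}"
      unfolding TG by (force simp: algebra_simps)
    then have "measure lebesgue (\<Union>k\<le>n. T k) \<le> measure lebesgue {g..g + c}"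
      using Tm by (intro measure_mono_fmeasurable) (auto intro: fmeasurableD)
    then show ?thesis using c by simp
  qed
  finally have le: "measure lebesgue A \<le> c" .
  have "A \<in> lmeasurable"
    by (rule bounded_set_imp_lmeasurable) (use A in \<open>auto intro: bounded_subset[of "{a..b}"]\<close>)
  then have "emeasure lebesgue A = ennreal (measure lebesgue A)"
    by (rule emeasure_eq_measure2)
  moreover have "emeasure lebesgue A = emeasure lborel A" using A(1) by simp
  ultimately show ?thesis using ennreal_leI[OF le] by simp
qed

lemma count_le_fun_upd:
  assumes "i \<in> {1..m}"
  shows "count_le m (x(i := y)) s = card {j \<in> {1..m} - {i}. x j \<le> s} + (if y \<le> s then 1 else 0)"
proof (cases "y \<le> s")
  case True
  then have "{j \<in> {1..m}. (x(i := y)) j \<le> s} = insert i {j \<in> {1..m} - {i}. x j \<le> s}"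
    using assms by auto
  then show ?thesis using True by (simp add: count_le_def)
next
  case False
  then have "{j \<in> {1..m}. (x(i := y)) j \<le> s} = {j \<in> {1..m} - {i}. x j \<le> s}"
    by auto
  then show ?thesis using False by (simp add: count_le_def)
qed

text \<open>Let \<open>F\<close> count the other p-values; coordinate \<open>i\<close> adds one at
  every threshold from its value on. For admissible \<open>y < z\<close>, testing \<open>y\<close>
  against the threshold \<open>z\<close> cancels this extra one and gives the lower bound. Testing
  \<open>z\<close> against the threshold \<open>y\<close> loses it, which costs the summand
  \<open>c\<close>.\<close>

lemma emeasure_boundary_at_le:
  assumes i: "i \<in> {1..m}" and c: "0 \<le> c" 
    and A: "A \<in> sets borel" "\<And>y. y \<in> A \<Longrightarrow> 0 \<le> y \<and> boundary_at m q c (x(i := y)) i"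
  shows "emeasure lborel A \<le> ennreal c"
proof (rule emeasure_increasing_part_le[OF A(1)])
  let ?F = "\<lambda>s. card {j \<in> {1..m} - {i}. x j \<le> s}"
  have b: "y - c * (?F y + 1) \<le> s - c * (?F s + (if y \<le> s then 1 else 0))" "y \<le> q"
    if "y \<in> A" "s \<in> {0..q}" for y s
    using A(2)[OF that(1)] that(2) unfolding boundary_at_def count_le_fun_upd[OF i] 
    by fastforce+
  show Aq: "A \<subseteq> {0..q}" using A(2) by (auto simp: boundary_at_def)
  show "?F \<in> borel \<rightarrow>\<^sub>M count_space UNIV" by measurable
  show "mono ?F" by (intro monoI card_mono) auto
  show "?F y \<le> m" for y
    by (rule order_trans[OF card_mono[of "{1..m}"]]) auto
  show "0 \<le> c" by fact
  fix y z assume yz: "y \<in> A" "z \<in> A" "y < z"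
  show "y - c * ?F y \<le> z - c * ?F z"
    using b(1)[of y z] yz Aq by (auto simp: algebra_simps)
  show "z - c * ?F z \<le> y - c * ?F y + c"
    using b(1)[of z y] yz Aq by (auto simp: algebra_simps)
qed

section \<open>Stopping rules on vectors of p-values\<close>

abbreviation pval_space :: "nat \<Rightarrow> (nat \<Rightarrow> real) measure" where
  "pval_space m \<equiv> Pi\<^sub>M {1..m} (\<lambda>_. borel)"

lemma count_above_measurable [measurable]:
  assumes [measurable]: "l \<in> borel_measurable (pval_space m)"
  shows "(\<lambda>x. count_above m x (l x)) \<in> pval_space m \<rightarrow>\<^sub>M count_space UNIV"
proof -
  have P: "Measurable.pred (pval_space m) (\<lambda>x. i \<in> {1..m} \<and> x i > l x)" for i
  proof (cases "i \<in> {1..m}")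
    case True
    then have [measurable]: "(\<lambda>x. x i) \<in> borel_measurable (pval_space m)" by simp
    have "Measurable.pred (pval_space m) (\<lambda>x. x i > l x)" by measurable
    then show ?thesis using True by simp
  next
    case False
    then have "(\<lambda>x. i \<in> {1..m} \<and> x i > l x) = (\<lambda>x. False)" by blast
    then show ?thesis by (simp only:) measurable
  qed
  have "{x \<in> space (pval_space m). i \<in> {i \<in> {1..m}. x i > l x}} \<in> sets (pval_space m)" for i
    using P[of i] unfolding pred_def mem_Collect_eq .
  then show ?thesis unfolding count_above_def by (rule measurable_card)
qed

lemma count_le_measurable [measurable]:
  assumes [measurable]: "l \<in> borel_measurable (pval_space m)"
  shows "(\<lambda>x. count_le m x (l x)) \<in> pval_space m \<rightarrow>\<^sub>M count_space UNIV"
proof -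
  have P: "Measurable.pred (pval_space m) (\<lambda>x. i \<in> {1..m} \<and> x i \<le> l x)" for i
  proof (cases "i \<in> {1..m}")
    case True
    then have "(\<lambda>x. x i) \<in> borel_measurable (pval_space m)" by simp
    from borel_measurable_le[OF this assms] show ?thesis using True by (simp add: pred_def)
  next
    case False
    then have "(\<lambda>x. i \<in> {1..m} \<and> x i \<le> l x) = (\<lambda>x. False)" by blast
    then show ?thesis by (simp only:) measurable
  qed
  have "{x \<in> space (pval_space m). i \<in> {i \<in> {1..m}. x i \<le> l x}} \<in> sets (pval_space m)" for i
    using P[of i] unfolding pred_def mem_Collect_eq .
  then show ?thesis unfolding count_le_def by (rule measurable_card)
qed

lemma count_above_cong: "(\<And>i. i \<in> {1..m} \<Longrightarrow> x i = y i) \<Longrightarrow> count_above m x s = count_above m y s"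
  unfolding count_above_def by (rule arg_cong[where f = card]) (rule Collect_cong, simp cong: conj_cong)

section \<open>The filtration of counts, carried over to vectors of p-values\<close>

lemma sets_count_filtration:
  "sets (count_filtration M m p q t) = sigma_sets (space M)
     {(\<lambda>\<omega>. count_above m (\<lambda>i. p i \<omega>) s) -` A \<inter> space M | s A. s \<in> {q..t}}"
  unfolding count_filtration_def by (rule sets_measure_of) auto

lemma space_count_filtration: "space (count_filtration M m p q t) = space M"
  unfolding count_filtration_def by (subst space_measure_of) auto

abbreviation vec_filtration :: "nat \<Rightarrow> real \<Rightarrow> real \<Rightarrow> (nat \<Rightarrow> real) measure" where
  "vec_filtration m q t \<equiv> count_filtration (pval_space m) m (\<lambda>i x. x i) q t"

lemma sets_vec_filtration_subset: "sets (vec_filtration m q t) \<subseteq> sets (pval_space m)"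
proof -
  have "(\<lambda>x. count_above m x s) -` A \<inter> space (pval_space m) \<in> sets (pval_space m)" for s A
    by (rule measurable_sets[OF count_above_measurable]) auto
  then show ?thesis
    unfolding sets_count_filtration by (intro sets.sigma_sets_subset) auto
qed

text \<open>Each generator on \<open>M\<close> is the preimage of the generator with the same
  \<open>s\<close> and \<open>A\<close> on vectors, and generating a sigma-algebra commutes with
  preimages.\<close>

lemma count_filtration_eq_vimage:
  assumes E: "E \<in> sets (count_filtration M m p q t)"
  obtains B where "B \<in> sets (vec_filtration m q t)"
    "E = (\<lambda>\<omega>. \<lambda>i\<in>{1..m}. p i \<omega>) -` B \<inter> space M"
proof -
  let ?P = "\<lambda>\<omega>. \<lambda>i\<in>{1..m}. p i \<omega>"
  let ?S = "space (pval_space m)"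
  have P: "?P \<in> space M \<rightarrow> ?S" by (auto simp: space_PiM)
  have cP: "count_above m (?P \<omega>) s = count_above m (\<lambda>i. p i \<omega>) s" for \<omega> s
    by (rule count_above_cong) simp
  have img: "{f A | A. A \<in> {h s B | s B. Q s}} = {f (h s B) | s B. Q s}"
    for f :: "'c \<Rightarrow> 'd" and h :: "real \<Rightarrow> 'e \<Rightarrow> 'c" and Q by blast
  have "{?P -` A \<inter> space M | A. A \<in> {(\<lambda>x. count_above m x s) -` A \<inter> ?S | s A. s \<in> {q..t}}}
    = {(\<lambda>\<omega>. count_above m (\<lambda>i. p i \<omega>) s) -` A \<inter> space M | s A. s \<in> {q..t}}" (is "?X = ?Y")
  proof -
    have "?P -` ((\<lambda>x. count_above m x s) -` A \<inter> ?S) \<inter> space M =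
       (\<lambda>\<omega>. count_above m (\<lambda>i. p i \<omega>) s) -` A \<inter> space M" for s A
      using P cP by auto
    moreover have "?X = {?P -` ((\<lambda>x. count_above m x s) -` A \<inter> ?S) \<inter> space M | s A. s \<in> {q..t}}"
      by (rule img)
    ultimately show ?thesis by (simp only:)
  qed
  then have "sets (count_filtration M m p q t) = {?P -` A \<inter> space M | A. A \<in> sets (vec_filtration m q t)}"
    unfolding sets_count_filtration sigma_sets_vimage_commute[OF P] by simp
  with E that show thesis by auto
qed

text \<open>The events that do not separate \<open>x\<close> from \<open>y\<close> are closed under
  complements and countable unions, and they include the generators because the counts
  agree.\<close>

lemma vec_filtration_agree:
  assumes B: "B \<in> sets (vec_filtration m q t)"
    and x: "x \<in> space (pval_space m)" and y: "y \<in> space (pval_space m)"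
    and eq: "\<And>s. s \<in> {q..t} \<Longrightarrow> count_above m x s = count_above m y s"
  shows "x \<in> B \<longleftrightarrow> y \<in> B"
  using B unfolding sets_count_filtration
proof (induction rule: sigma_sets.induct)
  case (Basic a)
  then show ?case using x y eq by auto
next
  case (Compl a)
  then show ?case using x y by auto
qed auto

text \<open>A pointwise stopping property in the manner of Galmarino's test. It speaks of arbitrary
  vectors because one with an entry reset to 0 need not be realised by any outcome.\<close>

definition stops_by_counts :: "nat \<Rightarrow> real \<Rightarrow> ((nat \<Rightarrow> real) \<Rightarrow> real) \<Rightarrow> bool" where
  "stops_by_counts m q g \<longleftrightarrow>
     (\<forall>x\<in>space (pval_space m). \<forall>y\<in>space (pval_space m). \<forall>u.
        (\<forall>s\<in>{q..<u}. count_above m x s = count_above m y s) \<longrightarrow> g x < u \<longrightarrow> g y = g x)"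

text \<open>A Doob-Dynkin factorisation of the stopping time, recovered from its sublevel sets at
  rational times.\<close>

lemma stopping_time_factorisation:
  assumes T: "stopping_time (count_filtration M m p q) T"
    and range: "\<And>\<omega>. \<omega> \<in> space M \<Longrightarrow> T \<omega> \<in> {q..1}" and q: "q \<le> 1"
  obtains g where "g \<in> borel_measurable (pval_space m)" "\<And>x. g x \<in> {q..1}"
    "\<And>\<omega>. \<omega> \<in> space M \<Longrightarrow> T \<omega> = g (\<lambda>i\<in>{1..m}. p i \<omega>)" "stops_by_counts m q g"
proof -
  let ?P = "\<lambda>\<omega>. \<lambda>i\<in>{1..m}. p i \<omega>"
  have "\<exists>B. B \<in> sets (vec_filtration m q t) \<and> {\<omega> \<in> space M. T \<omega> \<le> t} = ?P -` B \<inter> space M" for t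
  proof -
    have "{\<omega> \<in> space M. T \<omega> \<le> t} \<in> sets (count_filtration M m p q t)"
      using stopping_timeD[OF T, of t] by (simp add: pred_def space_count_filtration)
    from count_filtration_eq_vimage[OF this] obtain B where
      "B \<in> sets (vec_filtration m q t)" "{\<omega> \<in> space M. T \<omega> \<le> t} = ?P -` B \<inter> space M" .
    then show ?thesis by (intro exI conjI)
  qed
  then obtain B where B: "\<And>t. B t \<in> sets (vec_filtration m q t)"
    and TB: "\<And>t. {\<omega> \<in> space M. T \<omega> \<le> t} = ?P -` B t \<inter> space M"
    using choice[of "\<lambda>t B. B \<in> sets (vec_filtration m q t) \<and>
      {\<omega> \<in> space M. T \<omega> \<le> t} = ?P -` B \<inter> space M"] by blast
  have TB': "T \<omega> \<le> t \<longleftrightarrow> ?P \<omega> \<in> B t" if "\<omega> \<in> space M" for \<omega> t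
    using TB[of t] that by blast
  \<comment> \<open>The rational times by which \<open>x\<close> counts as stopped. Countability
    makes the infimum \<open>g\<close> measurable; the added 1 keeps the set nonempty and
    \<open>g\<close> at most 1.\<close>
  define Q where "Q x = insert 1 {r \<in> \<rat>. q \<le> r \<and> r < 1 \<and> x \<in> B r}" for x
  define g where "g x = Inf (Q x)" for x
  have bdd: "bdd_below (Q x)" for x by (rule bdd_belowI[of _ q]) (use q in \<open>auto simp: Q_def\<close>)
  have ne: "Q x \<noteq> {}" for x by (simp add: Q_def)
  have g_less: "g x < a \<longleftrightarrow> (\<exists>r\<in>Q x. r < a)" for x a
    unfolding g_def using bdd ne by (rule cInf_less_iff[rotated])
  have Bm [measurable]: "B t \<in> sets (pval_space m)" for t
    using B sets_vec_filtration_subset by blast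
  have gm: "g \<in> borel_measurable (pval_space m)"
  proof (rule borel_measurableI_less)
    fix a
    have "{x \<in> space (pval_space m). g x < a} =
      (if 1 < a then space (pval_space m) else \<Union>r\<in>{r \<in> \<rat>. q \<le> r \<and> r < 1 \<and> r < a}. B r)"
      unfolding g_less Q_def using sets.sets_into_space[OF Bm] by auto
    also have "\<dots> \<in> sets (pval_space m)"
      using Bm by (auto intro!: sets.countable_UN' countable_subset[OF _ countable_rat])
    finally show "{x \<in> space (pval_space m). g x < a} \<in> sets (pval_space m)" .
  qed
  have gr: "g x \<in> {q..1}" for x
  proof -
    have "q \<le> g x" unfolding g_def using q by (intro cInf_greatest ne) (auto simp: Q_def)
    moreover have "g x \<le> 1" unfolding g_def using bdd by (intro cInf_lower) (auto simp: Q_def)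
    ultimately show ?thesis by simp
  qed
  have gT: "T \<omega> = g (?P \<omega>)" if \<omega>: "\<omega> \<in> space M" for \<omega>
  proof (rule antisym)
    show "T \<omega> \<le> g (?P \<omega>)"
      unfolding g_def by (rule cInf_greatest[OF ne]) (use range[OF \<omega>] TB'[OF \<omega>] in \<open>auto simp: Q_def\<close>)
    show "g (?P \<omega>) \<le> T \<omega>"
    proof (rule ccontr)
      assume *: "\<not> g (?P \<omega>) \<le> T \<omega>"
      then obtain r where r: "r \<in> \<rat>" "T \<omega> < r" "r < g (?P \<omega>)"
        using Rats_dense_in_real[of "T \<omega>" "g (?P \<omega>)"] by auto
      then have "r \<in> Q (?P \<omega>)"
        using range[OF \<omega>] gr[of "?P \<omega>"] TB'[OF \<omega>, of r] by (auto simp: Q_def)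
      from cInf_lower[OF this bdd] r show False by (simp add: g_def)
    qed
  qed
  have "stops_by_counts m q g"
    unfolding stops_by_counts_def
  proof (intro ballI allI impI)
    fix x y u
    assume xy: "x \<in> space (pval_space m)" "y \<in> space (pval_space m)"
      and eq: "\<forall>s\<in>{q..<u}. count_above m x s = count_above m y s" and gu: "g x < u"
    \<comment> \<open>For \<open>r < u\<close> the event \<open>B r\<close> involves only counts at
      times in \<open>{q..r}\<close>, all before \<open>u\<close>, so it cannot tell
      \<open>x\<close> from \<open>y\<close>.\<close>
    have QQ: "r \<in> Q x \<longleftrightarrow> r \<in> Q y" if "r < u" for r
      using vec_filtration_agree[OF B xy, of r] eq that by (auto simp: Q_def)
    have *: "g x < a \<longleftrightarrow> g y < a" if "a \<le> u" for a
      unfolding g_less using QQ that by force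
    show "g y = g x"
    proof (rule antisym)
      show "g y \<le> g x"
      proof (rule dense_ge_bounded[OF gu])
        fix w assume "g x < w" "w < u"
        then show "g y \<le> w" using *[of w] by simp
      qed
      show "g x \<le> g y" using *[of "g x"] gu by force
    qed
  qed
  with gm gr gT show thesis by (rule that)
qed

text \<open>If \<open>x i\<close> and \<open>x j\<close> both exceed the rules stopped with that entry reset to \<open>0\<close>, then the two
  reset vectors have the same counts up to the earlier of the two times, so the times agree.
  Hence the nonzero summands are all equal to the reciprocal of one count, which bounds how many
  of them there are.\<close>

lemma sum_stopped_counts_le_1:
  assumes g: "stops_by_counts m q g" and gq: "\<And>x. q \<le> g x" and q: "0 < q"
    and x: "x \<in> space (pval_space m)" and N: "N \<subseteq> {1..m}"
  shows "(\<Sum>i\<in>N. (if g (x(i := 0)) < x i then 1 else 0) /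
      (1 + real (count_above m (x(i := 0)) (g (x(i := 0)))))) \<le> 1"
proof -
  let ?g = "\<lambda>i. g (x(i := 0))"
  define C where "C = {i \<in> N. ?g i < x i}"
  have fin: "finite N" using N finite_subset by blast
  have sp: "x(i := 0) \<in> space (pval_space m)" if "i \<in> N" for i
    using x N that by (auto simp: space_PiM PiE_def extensional_def)
  \<comment> \<open>As \<open>0 < q\<close> and \<open>q \<le> s\<close>, the reset entry does not
    exceed \<open>s\<close>, so exactly the contribution of \<open>i\<close> is lost.\<close>
  have cnt: "count_above m x s = 1 + count_above m (x(i := 0)) s"
    if "i \<in> N" "s < x i" "q \<le> s" for i s
  proof -
    have "{k \<in> {1..m}. x k > s} = insert i {k \<in> {1..m}. (x(i := 0)) k > s}"
      using that N q by auto
    moreover have "i \<notin> {k \<in> {1..m}. (x(i := 0)) k > s}" using that q by auto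
    ultimately show ?thesis by (simp add: count_above_def)
  qed
  have same: "?g j = ?g i" if "i \<in> C" "j \<in> C" for i j
  proof -
    have *: "?g j = ?g i" if ij: "i \<in> C" "j \<in> C" "?g i \<le> ?g j" for i j
    proof -
      have "count_above m (x(i := 0)) s = count_above m (x(j := 0)) s"
        if "s \<in> {q..<min (x i) (x j)}" for s
        using that ij cnt[of i s] cnt[of j s] by (auto simp: C_def)
      \<comment> \<open>The earlier time is below \<open>x i\<close> by membership in
        \<open>C\<close>, and below \<open>x j\<close> because it is at most \<open>?g j\<close>. So
        \<open>stops_by_counts\<close> applies with the smaller entry as \<open>u\<close>.\<close>
      moreover have "?g i < min (x i) (x j)" using ij by (auto simp: C_def)
      ultimately show ?thesis
        using g sp ij unfolding stops_by_counts_def C_def by blast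
    qed
    from *[of i j] *[of j i] that show ?thesis by linarith
  qed
  have "(\<Sum>i\<in>N. (if ?g i < x i then 1 else 0) / (1 + real (count_above m (x(i := 0)) (?g i)))) =
    (\<Sum>i\<in>C. 1 / (1 + real (count_above m (x(i := 0)) (?g i))))"
    unfolding C_def using fin by (intro sum.mono_neutral_cong_right) auto
  also have "\<dots> \<le> 1"
  proof (cases "C = {}")
    case False
    then obtain i0 where i0: "i0 \<in> C" by auto
    have "1 + real (count_above m (x(i := 0)) (?g i)) = count_above m x (?g i0)" if "i \<in> C" for i
      using cnt[of i "?g i"] that same[OF i0 that] gq by (auto simp: C_def)
    then have "(\<Sum>i\<in>C. 1 / (1 + real (count_above m (x(i := 0)) (?g i)))) =
      card C * (1 / count_above m x (?g i0))" by simp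
    also have "\<dots> \<le> 1"
    proof -
      have "C \<subseteq> {k \<in> {1..m}. x k > ?g i0}"
        using N same[OF i0] by (auto simp: C_def)
      then have "card C \<le> count_above m x (?g i0)"
        unfolding count_above_def by (intro card_mono) auto
      then show ?thesis by (simp add: divide_le_eq)
    qed
    finally show ?thesis .
  qed simp
  finally show ?thesis .
qed

section \<open>Integrating out one null p-value\<close>

text \<open>For positive \<open>m\<close> this is the inverse of \<open>m\<close> times the
  estimated null proportion at time \<open>g x\<close>; \<open>q\<close> times it is the slope of
  the rejection rule.\<close>

definition inv_null_est :: "nat \<Rightarrow> ((nat \<Rightarrow> real) \<Rightarrow> real) \<Rightarrow> (nat \<Rightarrow> real) \<Rightarrow> real" where
  "inv_null_est m g x = (1 - g x) / (1 + real (count_above m x (g x)))"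

text \<open>Taking the slope at the reset vector makes it constant along coordinate
  \<open>i\<close>. Nonnegativity is imposed because \<open>pval_space\<close> contains all real
  vectors.\<close>

definition boundary_event ::
  "nat \<Rightarrow> real \<Rightarrow> ((nat \<Rightarrow> real) \<Rightarrow> real) \<Rightarrow> nat \<Rightarrow> (nat \<Rightarrow> real) set" where
  "boundary_event m q g i = {x \<in> space (pval_space m). (\<forall>j\<in>{1..m}. 0 \<le> x j) \<and>
     boundary_at m q (q * inv_null_est m g (x(i := 0))) x i}"

text \<open>Integrating out a uniform coordinate \<open>i\<close> turns the indicator into 1 minus
  the stopping time, and the weight into \<open>inv_null_est\<close> at the reset vector.\<close>

definition resampled_weight :: "nat \<Rightarrow> ((nat \<Rightarrow> real) \<Rightarrow> real) \<Rightarrow> nat \<Rightarrow> (nat \<Rightarrow> real) \<Rightarrow> real" where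
  "resampled_weight m g i x = (if g (x(i := 0)) < x i then 1 else 0) /
      (1 + real (count_above m (x(i := 0)) (g (x(i := 0)))))"

lemma emeasure_uniform_01:
  assumes "A \<in> sets borel"
  shows "emeasure (uniform_measure lborel {0<..<1::real}) A = emeasure lborel ({0<..<1} \<inter> A)"
  using assms by (simp add: divide_ennreal_def)

lemma nn_integral_greaterThan_uniform_01:
  assumes "0 \<le> l" "l \<le> 1"
  shows "(\<integral>\<^sup>+y. indicator {l<..} y \<partial>uniform_measure lborel {0<..<1::real}) = ennreal (1 - l)"
proof -
  have "{0<..<1} \<inter> {l<..} = {l<..<1::real}" using assms by auto
  then show ?thesis using assms by (simp add: divide_ennreal_def)
qed

context
  fixes m :: nat and q :: real and g :: "(nat \<Rightarrow> real) \<Rightarrow> real" and i :: nat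
  assumes g [measurable]: "g \<in> borel_measurable (pval_space m)" and gq: "\<And>x. g x \<in> {q..1}"
    and q: "0 < q" and i: "i \<in> {1..m}"
begin

lemma fun_upd_0_measurable [measurable]: "(\<lambda>x. x(i := 0)) \<in> pval_space m \<rightarrow>\<^sub>M pval_space m"
  by (rule measurable_fun_upd[where J = "{1..m}"]) (use i in auto)

lemma coord_measurable: "j \<in> {1..m} \<Longrightarrow> (\<lambda>x. x j) \<in> borel_measurable (pval_space m)"
  by simp

lemma inv_null_est_measurable [measurable]: "inv_null_est m g \<in> borel_measurable (pval_space m)"
  unfolding inv_null_est_def by measurable

lemma count_above_upd_measurable [measurable]:
  "(\<lambda>x. count_above m (x(i := 0)) (g (x(i := 0)))) \<in> pval_space m \<rightarrow>\<^sub>M count_space UNIV"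
  by (rule measurable_compose[OF fun_upd_0_measurable count_above_measurable[OF g]])

lemma resampled_weight_measurable [measurable]:
  "resampled_weight m g i \<in> borel_measurable (pval_space m)"
proof -
  have "{x \<in> space (pval_space m). g (x(i := 0)) < x i} \<in> sets (pval_space m)"
    by (rule borel_measurable_less[OF measurable_compose[OF fun_upd_0_measurable g] coord_measurable[OF i]])
  then have "Measurable.pred (pval_space m) (\<lambda>x. g (x(i := 0)) < x i)"
    unfolding pred_def .
  moreover have "(\<lambda>x. real (count_above m (x(i := 0)) (g (x(i := 0))))) \<in> borel_measurable (pval_space m)"
    by (rule measurable_compose[OF count_above_upd_measurable]) simp
  ultimately show ?thesis unfolding resampled_weight_def
    by (intro borel_measurable_divide borel_measurable_add measurable_If) auto
qed

lemma boundary_event_measurable: "boundary_event m q g i \<in> sets (pval_space m)"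
proof -
  note [measurable] = coord_measurable[OF i]
  define c where "c x = q * inv_null_est m g (x(i := 0))" for x
  have c [measurable]: "c \<in> borel_measurable (pval_space m)"
    unfolding c_def by measurable
  define S where "S s = {x \<in> space (pval_space m). x i - c x * count_le m x (x i) \<le> s x - c x * count_le m x (s x)}"
    for s :: "(nat \<Rightarrow> real) \<Rightarrow> real"
  have cnt: "(\<lambda>x. real (count_le m x (s x))) \<in> borel_measurable (pval_space m)"
    if "s \<in> borel_measurable (pval_space m)" for s
    by (rule measurable_compose[OF count_le_measurable[OF that]]) simp
  have S: "S s \<in> sets (pval_space m)" if "s \<in> borel_measurable (pval_space m)" for s
    unfolding S_def by (intro borel_measurable_le borel_measurable_diff borel_measurable_times
        c that cnt coord_measurable i)
  have nn: "{x \<in> space (pval_space m). 0 \<le> x j} \<in> sets (pval_space m)" if "j \<in> {1..m}" for j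
    by (rule borel_measurable_le[OF _ coord_measurable[OF that]]) simp
  have le: "{x \<in> space (pval_space m). x j \<le> q} \<in> sets (pval_space m)" if "j \<in> {1..m}" for j
    by (rule borel_measurable_le[OF coord_measurable[OF that]]) simp
  \<comment> \<open>These are the conjuncts of \<open>boundary_at_finite\<close>, with the
    implication written as a union with a complement.\<close>
  have "boundary_event m q g i =
    {x \<in> space (pval_space m). \<forall>j\<in>{1..m}. x \<in> {x \<in> space (pval_space m). 0 \<le> x j}} \<inter>
    {x \<in> space (pval_space m). x i \<le> q} \<inter> S (\<lambda>_. 0) \<inter>
    {x \<in> space (pval_space m). \<forall>j\<in>{1..m}.
       x \<in> (space (pval_space m) - {x \<in> space (pval_space m). x j \<le> q}) \<union> S (\<lambda>x. x j)}"
    (is "_ = ?R")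
  proof (intro set_eqI)
    fix x
    show "x \<in> boundary_event m q g i \<longleftrightarrow> x \<in> ?R"
    proof (cases "x \<in> space (pval_space m) \<and> (\<forall>j\<in>{1..m}. 0 \<le> x j)")
      case True
      then have *: "boundary_at m q (c x) x i \<longleftrightarrow> x i \<le> q \<and>
        x i - c x * count_le m x (x i) \<le> - c x * count_le m x 0 \<and>
        (\<forall>j\<in>{1..m}. x j \<le> q \<longrightarrow> x i - c x * count_le m x (x i) \<le> x j - c x * count_le m x (x j))"
        by (intro boundary_at_finite q) auto
      show ?thesis
        using True unfolding boundary_event_def c_def[symmetric] mem_Collect_eq * S_def by auto
    next
      case False
      then show ?thesis unfolding boundary_event_def by blast
    qed
  qed
  also have "\<dots> \<in> sets (pval_space m)"
    using i nn le[OF i] le S[OF coord_measurable] S[of "\<lambda>_. 0"]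
    by (intro sets.Int sets.sets_Collect_finite_All') auto
  finally show ?thesis .
qed

text \<open>Fubini in coordinate \<open>i\<close>: with the others fixed, the slice of the event has
  mass at most the slope, while \<open>q\<close> times the weight integrates to exactly the
  slope.\<close>

lemma emeasure_boundary_event_le:
  fixes \<nu> :: "nat \<Rightarrow> real measure"
  assumes \<nu>: "\<And>k. prob_space (\<nu> k)" "\<And>k. sets (\<nu> k) = sets borel"
    and u: "\<nu> i = uniform_measure lborel {0<..<1}"
  shows "emeasure (Pi\<^sub>M {1..m} \<nu>) (boundary_event m q g i) \<le>
    (\<integral>\<^sup>+x. ennreal q * ennreal (resampled_weight m g i x) \<partial>Pi\<^sub>M {1..m} \<nu>)"
proof -
  let ?J = "{1..m} - {i}"
  let ?D = "boundary_event m q g i"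
  interpret product_sigma_finite \<nu>
    unfolding product_sigma_finite_def using \<nu>(1) prob_space_imp_sigma_finite by blast
  have ins: "insert i ?J = {1..m}" using i by auto
  have sV: "sets (Pi\<^sub>M {1..m} \<nu>) = sets (pval_space m)"
    by (rule sets_PiM_cong) (auto simp: \<nu>(2))
  have D: "?D \<in> sets (Pi\<^sub>M {1..m} \<nu>)" using boundary_event_measurable sV by simp
  have split: "integral\<^sup>N (Pi\<^sub>M {1..m} \<nu>) f = (\<integral>\<^sup>+x. \<integral>\<^sup>+y. f (x(i := y)) \<partial>\<nu> i \<partial>Pi\<^sub>M ?J \<nu>)"
    if f: "f \<in> borel_measurable (pval_space m)" for f
  proof -
    have "f \<in> borel_measurable (Pi\<^sub>M (insert i ?J) \<nu>)"
      using f unfolding ins measurable_cong_sets[OF sV refl] .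
    from product_nn_integral_insert[OF _ _ this] show ?thesis unfolding ins by simp
  qed
  have slice: "(\<integral>\<^sup>+y. indicator ?D (x(i := y)) \<partial>\<nu> i) \<le>
      (\<integral>\<^sup>+y. ennreal q * ennreal (resampled_weight m g i (x(i := y))) \<partial>\<nu> i)"
    if x: "x \<in> space (Pi\<^sub>M ?J \<nu>)" for x
  proof -
    define l where "l = g (x(i := 0))"
    define N where "N = real (count_above m (x(i := 0)) l)"
    define A where "A = {y. x(i := y) \<in> ?D}"
    have l: "0 \<le> l" "l \<le> 1" using gq[of "x(i := 0)"] q by (auto simp: l_def)
    have xJ: "x \<in> space (Pi\<^sub>M ?J (\<lambda>_. borel))"
      using x by (auto simp: space_PiM sets_eq_imp_space_eq[OF \<nu>(2)])
    have upd: "(\<lambda>y. x(i := y)) \<in> borel \<rightarrow>\<^sub>M pval_space m"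
      by (rule measurable_fun_upd[where J = ?J]) (use ins xJ in auto)
    have A: "A \<in> sets borel"
      using measurable_sets[OF upd boundary_event_measurable] by (simp add: A_def vimage_def)
    have c: "q * inv_null_est m g (x(i := 0)) = q * ((1 - l) / (1 + N))"
      by (simp add: inv_null_est_def l_def N_def)
    have N0: "0 \<le> N" by (simp add: N_def)
    have "emeasure lborel A \<le> ennreal (q * ((1 - l) / (1 + N)))"
    proof (rule emeasure_boundary_at_le[OF i _ A])
      show "0 \<le> q * ((1 - l) / (1 + N))" using q l N0 by simp
      fix y assume "y \<in> A"
      then have "\<forall>j\<in>{1..m}. 0 \<le> (x(i := y)) j"
        "boundary_at m q (q * ((1 - l) / (1 + N))) (x(i := y)) i"
        unfolding A_def boundary_event_def mem_Collect_eq fun_upd_upd c by blast+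
      then show "0 \<le> y \<and> boundary_at m q (q * ((1 - l) / (1 + N))) (x(i := y)) i"
        using i by (metis fun_upd_same)
    qed
    moreover have "(\<integral>\<^sup>+y. indicator ?D (x(i := y)) \<partial>\<nu> i) = emeasure (\<nu> i) A"
    proof -
      have "indicator ?D (x(i := y)) = (indicator A y :: ennreal)" for y
        by (simp add: A_def indicator_def)
      then show ?thesis using A by (simp add: \<nu>(2))
    qed
    \<comment> \<open>The uniform law is Lebesgue measure restricted to the unit interval.\<close>
    moreover have "emeasure (\<nu> i) A \<le> emeasure lborel A"
      unfolding u emeasure_uniform_01[OF A] using A by (intro emeasure_mono) auto
    moreover have "(\<integral>\<^sup>+y. ennreal q * ennreal (resampled_weight m g i (x(i := y))) \<partial>\<nu> i) =
      ennreal (q * ((1 - l) / (1 + N)))"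
    proof -
      have "ennreal q * ennreal (resampled_weight m g i (x(i := y))) =
        ennreal (q / (1 + N)) * indicator {l<..} y" for y
        using q N0 by (auto simp: resampled_weight_def l_def[symmetric] N_def[symmetric]
            simp flip: ennreal_mult split: split_indicator)
      then have "(\<integral>\<^sup>+y. ennreal q * ennreal (resampled_weight m g i (x(i := y))) \<partial>\<nu> i) =
        ennreal (q / (1 + N)) * (\<integral>\<^sup>+y. indicator {l<..} y \<partial>\<nu> i)"
        by (simp only:) (intro nn_integral_cmult borel_measurable_indicator, simp add: \<nu>(2))
      also have "\<dots> = ennreal (q / (1 + N)) * ennreal (1 - l)"
        unfolding u nn_integral_greaterThan_uniform_01[OF l] ..
      also have "\<dots> = ennreal (q * ((1 - l) / (1 + N)))"
        using q N0 l by (simp flip: ennreal_mult)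
      finally show ?thesis .
    qed
    ultimately show ?thesis by simp
  qed
  have "emeasure (Pi\<^sub>M {1..m} \<nu>) ?D = (\<integral>\<^sup>+x. indicator ?D x \<partial>Pi\<^sub>M {1..m} \<nu>)"
    using D by simp
  also have "\<dots> = (\<integral>\<^sup>+x. \<integral>\<^sup>+y. indicator ?D (x(i := y)) \<partial>\<nu> i \<partial>Pi\<^sub>M ?J \<nu>)"
    using boundary_event_measurable by (intro split borel_measurable_indicator)
  also have "\<dots> \<le> (\<integral>\<^sup>+x. \<integral>\<^sup>+y. ennreal q * ennreal (resampled_weight m g i (x(i := y))) \<partial>\<nu> i \<partial>Pi\<^sub>M ?J \<nu>)"
    by (intro nn_integral_mono slice)
  also have "\<dots> = (\<integral>\<^sup>+x. ennreal q * ennreal (resampled_weight m g i x) \<partial>Pi\<^sub>M {1..m} \<nu>)"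
    by (rule split[symmetric]) measurable
  finally show ?thesis .
qed

end

section \<open>Covering by boundary events, union bound and conclusion\<close>

theorem proposition3p1:
  fixes M :: "'a measure" and m :: nat and q :: real
    and H :: "nat \<Rightarrow> bool" and p :: "nat \<Rightarrow> 'a \<Rightarrow> real"
    and lam :: "'a \<Rightarrow> real" and R :: "'a \<Rightarrow> nat"
  assumes "prob_space M"
    and "m \<ge> 1" and "0 < q" and "q < 1"
    and "\<And>i \<omega>. i \<in> {1..m} \<Longrightarrow> \<omega> \<in> space M \<Longrightarrow> p i \<omega> \<in> {0..1}"
    and "prob_space.indep_vars M (\<lambda>_. borel) p {1..m}"
    and "\<And>i. i \<in> {1..m} \<Longrightarrow> H i \<Longrightarrow> distr M borel (p i) = uniform_measure lborel {0<..<1}"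
    and "\<And>\<omega>. \<omega> \<in> space M \<Longrightarrow> lam \<omega> \<in> {q..1}"
    and "stopping_time (count_filtration M m p q) lam"
    and "R \<in> M \<rightarrow>\<^sub>M count_space UNIV"
    and "\<And>\<omega>. \<omega> \<in> space M \<Longrightarrow>
           is_rejection_count m q (\<lambda>i. p i \<omega>) (pi0_hat m (\<lambda>i. p i \<omega>) (lam \<omega>)) (R \<omega>)"
  shows "bFDR M m H p (\<lambda>\<omega>. rejection_set m (\<lambda>i. p i \<omega>) (R \<omega>)) \<le> q"
proof -
  interpret prob_space M by fact
  have q1: "q \<le> 1" using assms(4) by simp
  obtain g where g: "g \<in> borel_measurable (pval_space m)" and gq: "\<And>x. g x \<in> {q..1}"
    and lam: "\<And>\<omega>. \<omega> \<in> space M \<Longrightarrow> lam \<omega> = g (\<lambda>i\<in>{1..m}. p i \<omega>)" and gs: "stops_by_counts m q g"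
    using stopping_time_factorisation[OF assms(9,8) q1] by metis
  define N where "N = {i \<in> {1..m}. H i}"
  define P where "P \<omega> = (\<lambda>i\<in>{1..m}. p i \<omega>)" for \<omega>
  let ?D = "boundary_event m q g"
  have pm: "p i \<in> borel_measurable M" if "i \<in> {1..m}" for i
    using assms(6) that by (auto simp: indep_vars_def)
  have P [measurable]: "P \<in> M \<rightarrow>\<^sub>M pval_space m"
    unfolding P_def by (rule measurable_restrict) (rule pm)
  \<comment> \<open>Indices outside \<open>{1..m}\<close> get a point mass, since
    \<open>emeasure_boundary_event_le\<close> asks for a probability measure at every index.\<close>
  define \<nu> where "\<nu> i = (if i \<in> {1..m} then distr M borel (p i) else return borel 0)" for i
  have \<nu>: "prob_space (\<nu> k)" "sets (\<nu> k) = sets borel" for k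
    using pm by (auto simp: \<nu>_def prob_space_distr prob_space_return)
  have law: "distr M (pval_space m) P = Pi\<^sub>M {1..m} \<nu>"
  proof -
    have "distr M (pval_space m) P = Pi\<^sub>M {1..m} (\<lambda>i. distr M borel (p i))"
      unfolding P_def using assms(2,6) pm by (subst indep_vars_iff_distr_eq_PiM'[symmetric]) auto
    also have "\<dots> = Pi\<^sub>M {1..m} \<nu>" by (rule PiM_cong) (auto simp: \<nu>_def)
    finally show ?thesis .
  qed
  have "{\<omega> \<in> space M. ordered_null m H (\<lambda>i. p i \<omega>) (card (rejection_set m (\<lambda>i. p i \<omega>) (R \<omega>)))
      \<and> card (rejection_set m (\<lambda>i. p i \<omega>) (R \<omega>)) > 0} \<subseteq> (\<Union>i\<in>N. P -` ?D i \<inter> space M)" (is "?E \<subseteq> _")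
  proof
    fix \<omega> assume \<omega>: "\<omega> \<in> ?E"
    let ?x = "\<lambda>i. p i \<omega>"
    have sp: "\<omega> \<in> space M" using \<omega> by simp
    have x0: "0 \<le> ?x j" if "j \<in> {1..m}" for j using assms(5)[OF that sp] by simp
    have rc: "is_rejection_count m q ?x (pi0_hat m ?x (lam \<omega>)) (R \<omega>)" using assms(11) sp .
    then have Rm: "R \<omega> \<le> m" by (simp add: is_rejection_count_def is_arg_min_def)
    have "order_stat m ?x (card (rejection_set m ?x (R \<omega>))) = order_stat m ?x (R \<omega>)"
      by (rule order_stat_card_rejection_set[OF x0 Rm]) (use \<omega> in auto)
    then obtain i where i: "i \<in> {1..m}" "H i" "?x i = order_stat m ?x (R \<omega>)"
      using \<omega> by (auto simp: ordered_null_def)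
    have b: "boundary_at m q (q * ((1 - lam \<omega>) / (1 + count_above m ?x (lam \<omega>)))) ?x i"
      using assms(2,3,8) sp by (intro boundary_at_rejection_count[OF rc x0 _ _ _ i(3)]) auto
    have Psp: "P \<omega> \<in> space (pval_space m)" using measurable_space[OF P sp] .
    have P0sp: "(P \<omega>)(i := 0) \<in> space (pval_space m)"
      using Psp i by (auto simp: space_PiM PiE_def extensional_def)
    have xq: "?x i \<le> q" using b by (simp add: boundary_at_def)
    \<comment> \<open>As \<open>?x i \<le> q\<close> and \<open>q \<le> s\<close>, neither
      \<open>?x i\<close> nor 0 exceeds \<open>s\<close>.\<close>
    have cnt: "count_above m ?x s = count_above m ((P \<omega>)(i := 0)) s"
      "count_above m ?x s = count_above m (P \<omega>) s" if "q \<le> s" for s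
      using that xq assms(3) unfolding count_above_def P_def
      by (auto intro!: arg_cong[where f = card])
    \<comment> \<open>The bound \<open>u = 2\<close> lies beyond every stopping time, as
      \<open>g\<close> is at most 1, and the counts agree at all times from \<open>q\<close>
      on.\<close>
    have "g ((P \<omega>)(i := 0)) = g (P \<omega>)"
      using gs Psp P0sp cnt gq[of "P \<omega>"] unfolding stops_by_counts_def
      by (elim ballE[of _ _ "P \<omega>"] ballE[of _ _ "(P \<omega>)(i := 0)"] allE[of _ 2]) auto
    then have g0: "g ((P \<omega>)(i := 0)) = lam \<omega>" using lam[OF sp] by (simp add: P_def)
    have c: "inv_null_est m g ((P \<omega>)(i := 0)) = (1 - lam \<omega>) / (1 + count_above m ?x (lam \<omega>))"
      unfolding inv_null_est_def g0 using cnt(1)[of "lam \<omega>"] assms(8)[OF sp] by simp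
    have cl: "count_le m (P \<omega>) s = count_le m ?x s" for s
      unfolding count_le_def P_def by (auto intro!: arg_cong[where f = card])
    have Pj: "P \<omega> j = ?x j" if "j \<in> {1..m}" for j using that by (simp add: P_def)
    have "boundary_at m q k (P \<omega>) i = boundary_at m q k ?x i" for k
      unfolding boundary_at_def cl Pj[OF i(1)] ..
    then have "P \<omega> \<in> ?D i"
      using Psp x0 b Pj unfolding boundary_event_def c mem_Collect_eq by metis
    then show "\<omega> \<in> (\<Union>i\<in>N. P -` ?D i \<inter> space M)" using i sp by (auto simp: N_def)
  qed
  have D: "?D i \<in> sets (pval_space m)" if "i \<in> N" for i
    using that by (intro boundary_event_measurable[OF g gq assms(3)]) (auto simp: N_def)
  have DP: "P -` ?D i \<inter> space M \<in> sets M" if "i \<in> N" for i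
    using measurable_sets[OF P D[OF that]] .
  have fin: "finite N" by (simp add: N_def)
  interpret V: prob_space "Pi\<^sub>M {1..m} \<nu>"
    unfolding law[symmetric] by (rule prob_space_distr) (rule P)
  have sV: "sets (Pi\<^sub>M {1..m} \<nu>) = sets (pval_space m)"
    unfolding law[symmetric] by simp
  have "emeasure M (\<Union>i\<in>N. P -` ?D i \<inter> space M) \<le> (\<Sum>i\<in>N. emeasure M (P -` ?D i \<inter> space M))"
    using DP fin by (intro emeasure_subadditive_finite) auto
  also have "\<dots> = (\<Sum>i\<in>N. emeasure (Pi\<^sub>M {1..m} \<nu>) (?D i))"
    unfolding law[symmetric] by (intro sum.cong refl emeasure_distr[OF P D, symmetric])
  also have "\<dots> \<le> (\<Sum>i\<in>N. \<integral>\<^sup>+x. ennreal q * ennreal (resampled_weight m g i x) \<partial>Pi\<^sub>M {1..m} \<nu>)"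
  proof (rule sum_mono)
    fix i assume "i \<in> N"
    then show "emeasure (Pi\<^sub>M {1..m} \<nu>) (?D i) \<le>
      (\<integral>\<^sup>+x. ennreal q * ennreal (resampled_weight m g i x) \<partial>Pi\<^sub>M {1..m} \<nu>)"
      by (intro emeasure_boundary_event_le[OF g gq assms(3)] \<nu>) (auto simp: N_def \<nu>_def assms(7))
  qed
  \<comment> \<open>With the sum inside the integral, the pointwise bound on the weights handles all
    true nulls at once.\<close>
  also have "\<dots> = (\<integral>\<^sup>+x. (\<Sum>i\<in>N. ennreal q * ennreal (resampled_weight m g i x)) \<partial>Pi\<^sub>M {1..m} \<nu>)"
  proof (rule nn_integral_sum[symmetric])
    fix i assume "i \<in> N"
    then have "resampled_weight m g i \<in> borel_measurable (pval_space m)"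
      by (intro resampled_weight_measurable[OF g gq assms(3)]) (auto simp: N_def)
    then have [measurable]: "resampled_weight m g i \<in> borel_measurable (Pi\<^sub>M {1..m} \<nu>)"
      unfolding measurable_cong_sets[OF sV refl] .
    show "(\<lambda>x. ennreal q * ennreal (resampled_weight m g i x)) \<in> borel_measurable (Pi\<^sub>M {1..m} \<nu>)"
      by measurable
  qed
  also have "\<dots> \<le> (\<integral>\<^sup>+x. ennreal q \<partial>Pi\<^sub>M {1..m} \<nu>)"
  proof (rule nn_integral_mono)
    fix x assume "x \<in> space (Pi\<^sub>M {1..m} \<nu>)"
    then have "x \<in> space (pval_space m)" using sets_eq_imp_space_eq[OF sV] by simp
    then have "(\<Sum>i\<in>N. resampled_weight m g i x) \<le> 1"
      unfolding resampled_weight_def using gq assms(3)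
      by (intro sum_stopped_counts_le_1[OF gs]) (auto simp: N_def)
    moreover have "0 \<le> resampled_weight m g i x" for i by (simp add: resampled_weight_def)
    ultimately have "ennreal q * (\<Sum>i\<in>N. ennreal (resampled_weight m g i x)) \<le> ennreal q * 1"
      by (intro mult_left_mono) (auto simp: sum_ennreal)
    then show "(\<Sum>i\<in>N. ennreal q * ennreal (resampled_weight m g i x)) \<le> ennreal q"
      by (simp add: sum_distrib_left)
  qed
  also have "\<dots> = ennreal q" using V.emeasure_space_1 by simp
  finally have "measure M (\<Union>i\<in>N. P -` ?D i \<inter> space M) \<le> q"
    using assms(3) by (simp add: emeasure_eq_measure)
  moreover have "measure M ?E \<le> measure M (\<Union>i\<in>N. P -` ?D i \<inter> space M)"
    using \<open>?E \<subseteq> _\<close> DP fin by (intro finite_measure_mono sets.finite_UN) auto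
  ultimately show ?thesis unfolding bFDR_def by simp
qed

end
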